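(* Let $\Bbbk$ be a field, let $(A,\mu_A,\alpha_A,\beta_A)$ be a BiHom-associative algebra over $\Bbbk$, let $(M,l,r,\alpha_M,\beta_M)$ be an $A$-bimodule (with actions written $x\cdot m$ and $m\cdot x$), let $H:A\otimes A\to M$ be a Hochschild 2-cocycle on $A$ with values in $M$, and let $\pi:M\to A$ be an $H$-twisted Rota-Baxter operator. Define the following operations on $M$: $$m\prec n=m\cdot\pi(n),\qquad m\succ n=\pi(m)\cdot n,\qquad m\vee n=H(\pi(m),\pi(n)),$$ for all $m,n\in M$. Then $(M,\prec,\succ,\vee,\alpha_M,\beta_M)$ is a BiHom-NS-algebra.
   Context: Everything is over a field $\Bbbk$; all maps are linear; algebras are not assumed associative or unital. A BiHom-associative algebra $(A,\mu,\alpha,\beta)$ is a linear space $A$ with linear maps $\mu:A\otimes A\to A$, $\mu(x\otimes y)=xy$, and $\alpha,\beta:A\to A$ such that $\alpha\circ\beta=\beta\circ\alpha$, $\alpha(xy)=\alpha(x)\alpha(y)$, $\beta(xy)=\beta(x)\beta(y)$ and $\alpha(x)(yz)=(xy)\beta(z)$ for all $x,y,z\in A$. An $A$-bimodule $(M,l,r,\alpha_M,\beta_M)$ over a BiHom-associative algebra $(A,\mu_A,\alpha_A,\beta_A)$ is a linear space $M$ with commuting linear maps $\alpha_M,\beta_M:M\to M$ and linear maps $l:A\otimes M\to M$, $x\otimes m\mapsto x\cdot m$, and $r:M\otimes A\to M$, $m\otimes x\mapsto m\cdot x$, such that for all $x,x'\in A$, $m\in M$: $\alpha_M(x\cdot m)=\alpha_A(x)\cdot\alpha_M(m)$,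 $\beta_M(x\cdot m)=\beta_A(x)\cdot\beta_M(m)$, $\alpha_M(m\cdot x)=\alpha_M(m)\cdot\alpha_A(x)$, $\beta_M(m\cdot x)=\beta_M(m)\cdot\beta_A(x)$, $\alpha_A(x)\cdot(x'\cdot m)=(xx')\cdot\beta_M(m)$, $\alpha_M(m)\cdot(xx')=(m\cdot x)\cdot\beta_A(x')$, and $\alpha_A(x)\cdot(m\cdot x')=(x\cdot m)\cdot\beta_A(x')$. A Hochschild 2-cocycle on $A$ with values in $M$ is a linear map $H:A\otimes A\to M$ with $H\circ(\alpha_A\otimes\alpha_A)=\alpha_M\circ H$, $H\circ(\beta_A\otimes\beta_A)=\beta_M\circ H$ and $\alpha_A(x)\cdot H(y,z)-H(xy,\beta_A(z))+H(\alpha_A(x),yz)-H(x,y)\cdot\beta_A(z)=0$ for all $x,y,z\in A$. An $H$-twisted Rota-Baxter operator is a linear map $\pi:M\to A$ with $\pi\circ\alpha_M=\alpha_A\circ\pi$, $\pi\circ\beta_M=\beta_A\circ\pi$ and $\pi(m)\pi(n)=\pi\big(\pi(m)\cdot n+m\cdot\pi(n)+H(\pi(m),\pi(n))\big)$ for all $m,n\in M$. A BiHom-NS-algebra $(A,\prec,\succ,\vee,\alpha,\beta)$ is a linear space $A$ with linear maps $\prec,\succ,\vee:A\otimes A\to A$ and $\alpha,\beta:A\to A$ such that $\alpha\circ\beta=\beta\circ\alpha$, both $\alpha$ and $\beta$ are multiplicative with respect to each of $\prec,\succ,\vee$ (e.g. $\alpha(x\prec y)=\alpha(x)\prec\alpha(y)$),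 and, writing $x\ast y=x\prec y+x\succ y+x\vee y$, for all $x,y,z\in A$: $(x\prec y)\prec\beta(z)=\alpha(x)\prec(y\ast z)$; $(x\succ y)\prec\beta(z)=\alpha(x)\succ(y\prec z)$; $(x\ast y)\succ\beta(z)=\alpha(x)\succ(y\succ z)$; $(x\vee y)\prec\beta(z)+(x\ast y)\vee\beta(z)=\alpha(x)\succ(y\vee z)+\alpha(x)\vee(y\ast z)$. *)

theory Defs
  imports "HOL.Vector_Spaces"
begin

text \<open>
  A linear space over a field \<open>'k\<close> is an abelian group type together with a scalar
  multiplication satisfying the locale \<^locale>\<open>vector_space\<close>.  A linear map out of a tensor
  product \<open>V \<otimes> W\<close> is given as the corresponding curried bilinear map on \<open>V \<times> W\<close>.
\<close>

definition bilinear_map ::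
  "('k::field \<Rightarrow> 'u::ab_group_add \<Rightarrow> 'u) \<Rightarrow> ('k \<Rightarrow> 'v::ab_group_add \<Rightarrow> 'v) \<Rightarrow>
   ('k \<Rightarrow> 'w::ab_group_add \<Rightarrow> 'w) \<Rightarrow> ('u \<Rightarrow> 'v \<Rightarrow> 'w) \<Rightarrow> bool" where
  "bilinear_map s1 s2 s3 f \<longleftrightarrow>
     (\<forall>u. Vector_Spaces.linear s2 s3 (\<lambda>v. f u v)) \<and>
     (\<forall>v. Vector_Spaces.linear s1 s3 (\<lambda>u. f u v))"

locale bihom_associative_algebra = vector_space scale
  for scale :: "'k::field \<Rightarrow> 'a::ab_group_add \<Rightarrow> 'a" +
  fixes mult :: "'a \<Rightarrow> 'a \<Rightarrow> 'a" (infixl \<open>\<odot>\<close> 70)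
    and \<alpha> \<beta> :: "'a \<Rightarrow> 'a"
  assumes mult_bilinear: "bilinear_map scale scale scale (\<odot>)"
    and alpha_linear: "Vector_Spaces.linear scale scale \<alpha>"
    and beta_linear: "Vector_Spaces.linear scale scale \<beta>"
    and alpha_beta_commute: "\<alpha> \<circ> \<beta> = \<beta> \<circ> \<alpha>"
    and alpha_mult: "\<alpha> (x \<odot> y) = \<alpha> x \<odot> \<alpha> y"
    and beta_mult: "\<beta> (x \<odot> y) = \<beta> x \<odot> \<beta> y"
    and bihom_assoc: "\<alpha> x \<odot> (y \<odot> z) = (x \<odot> y) \<odot> \<beta> z"

locale bihom_bimodule =
  bihom_associative_algebra scaleA mult \<alpha>A \<beta>A + M: vector_space scaleM
  for scaleA :: "'k::field \<Rightarrow> 'a::ab_group_add \<Rightarrow> 'a"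
    and mult :: "'a \<Rightarrow> 'a \<Rightarrow> 'a" (infixl \<open>\<odot>\<close> 70)
    and \<alpha>A \<beta>A :: "'a \<Rightarrow> 'a"
    and scaleM :: "'k \<Rightarrow> 'm::ab_group_add \<Rightarrow> 'm" +
  fixes left_act :: "'a \<Rightarrow> 'm \<Rightarrow> 'm" (infixr \<open>\<rhd>\<close> 70)
    and right_act :: "'m \<Rightarrow> 'a \<Rightarrow> 'm" (infixl \<open>\<lhd>\<close> 70)
    and \<alpha>M \<beta>M :: "'m \<Rightarrow> 'm"
  assumes left_act_bilinear: "bilinear_map scaleA scaleM scaleM (\<rhd>)"
    and right_act_bilinear: "bilinear_map scaleM scaleA scaleM (\<lhd>)"
    and alphaM_linear: "Vector_Spaces.linear scaleM scaleM \<alpha>M"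
    and betaM_linear: "Vector_Spaces.linear scaleM scaleM \<beta>M"
    and alphaM_betaM_commute: "\<alpha>M \<circ> \<beta>M = \<beta>M \<circ> \<alpha>M"
    and alphaM_left_act: "\<alpha>M (x \<rhd> m) = \<alpha>A x \<rhd> \<alpha>M m"
    and betaM_left_act: "\<beta>M (x \<rhd> m) = \<beta>A x \<rhd> \<beta>M m"
    and alphaM_right_act: "\<alpha>M (m \<lhd> x) = \<alpha>M m \<lhd> \<alpha>A x"
    and betaM_right_act: "\<beta>M (m \<lhd> x) = \<beta>M m \<lhd> \<beta>A x"
    and left_act_assoc: "\<alpha>A x \<rhd> (x' \<rhd> m) = (x \<odot> x') \<rhd> \<beta>M m"
    and right_act_assoc: "\<alpha>M m \<lhd> (x \<odot> x') = (m \<lhd> x) \<lhd> \<beta>A x'"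
    and left_right_act_assoc: "\<alpha>A x \<rhd> (m \<lhd> x') = (x \<rhd> m) \<lhd> \<beta>A x'"

locale hochschild_2_cocycle =
  bihom_bimodule scaleA mult \<alpha>A \<beta>A scaleM left_act right_act \<alpha>M \<beta>M
  for scaleA :: "'k::field \<Rightarrow> 'a::ab_group_add \<Rightarrow> 'a"
    and mult :: "'a \<Rightarrow> 'a \<Rightarrow> 'a" (infixl \<open>\<odot>\<close> 70)
    and \<alpha>A \<beta>A :: "'a \<Rightarrow> 'a"
    and scaleM :: "'k \<Rightarrow> 'm::ab_group_add \<Rightarrow> 'm"
    and left_act :: "'a \<Rightarrow> 'm \<Rightarrow> 'm" (infixr \<open>\<rhd>\<close> 70)
    and right_act :: "'m \<Rightarrow> 'a \<Rightarrow> 'm" (infixl \<open>\<lhd>\<close> 70)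
    and \<alpha>M \<beta>M :: "'m \<Rightarrow> 'm" +
  fixes H :: "'a \<Rightarrow> 'a \<Rightarrow> 'm"
  assumes H_bilinear: "bilinear_map scaleA scaleA scaleM H"
    and H_alpha: "H (\<alpha>A x) (\<alpha>A y) = \<alpha>M (H x y)"
    and H_beta: "H (\<beta>A x) (\<beta>A y) = \<beta>M (H x y)"
    and H_cocycle:
      "\<alpha>A x \<rhd> H y z - H (x \<odot> y) (\<beta>A z) + H (\<alpha>A x) (y \<odot> z) - H x y \<lhd> \<beta>A z = 0"

locale twisted_rota_baxter_operator =
  hochschild_2_cocycle scaleA mult \<alpha>A \<beta>A scaleM left_act right_act \<alpha>M \<beta>M H
  for scaleA :: "'k::field \<Rightarrow> 'a::ab_group_add \<Rightarrow> 'a"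
    and mult :: "'a \<Rightarrow> 'a \<Rightarrow> 'a" (infixl \<open>\<odot>\<close> 70)
    and \<alpha>A \<beta>A :: "'a \<Rightarrow> 'a"
    and scaleM :: "'k \<Rightarrow> 'm::ab_group_add \<Rightarrow> 'm"
    and left_act :: "'a \<Rightarrow> 'm \<Rightarrow> 'm" (infixr \<open>\<rhd>\<close> 70)
    and right_act :: "'m \<Rightarrow> 'a \<Rightarrow> 'm" (infixl \<open>\<lhd>\<close> 70)
    and \<alpha>M \<beta>M :: "'m \<Rightarrow> 'm"
    and H :: "'a \<Rightarrow> 'a \<Rightarrow> 'm" +
  fixes \<pi> :: "'m \<Rightarrow> 'a"
  assumes pi_linear: "Vector_Spaces.linear scaleM scaleA \<pi>"
    and pi_alpha: "\<pi> \<circ> \<alpha>M = \<alpha>A \<circ> \<pi>"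
    and pi_beta: "\<pi> \<circ> \<beta>M = \<beta>A \<circ> \<pi>"
    and pi_rota_baxter: "\<pi> m \<odot> \<pi> n = \<pi> (\<pi> m \<rhd> n + m \<lhd> \<pi> n + H (\<pi> m) (\<pi> n))"

text \<open>
  The third operation, usually written \<open>\<or>\<close>, is written \<open>\<squnion>\<close> to avoid a clash with disjunction; the
  sum \<open>x \<prec> y + x \<succ> y + x \<squnion> y\<close>, usually abbreviated \<open>x * y\<close>, is written out.
\<close>

locale bihom_ns_algebra = vector_space scale
  for scale :: "'k::field \<Rightarrow> 'v::ab_group_add \<Rightarrow> 'v" +
  fixes prec :: "'v \<Rightarrow> 'v \<Rightarrow> 'v" (infixl \<open>\<prec>\<close> 70)
    and succ :: "'v \<Rightarrow> 'v \<Rightarrow> 'v" (infixl \<open>\<succ>\<close> 70)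
    and vee :: "'v \<Rightarrow> 'v \<Rightarrow> 'v" (infixl \<open>\<squnion>\<close> 70)
    and \<alpha> \<beta> :: "'v \<Rightarrow> 'v"
  assumes prec_bilinear: "bilinear_map scale scale scale (\<prec>)"
    and succ_bilinear: "bilinear_map scale scale scale (\<succ>)"
    and vee_bilinear: "bilinear_map scale scale scale (\<squnion>)"
    and alpha_linear: "Vector_Spaces.linear scale scale \<alpha>"
    and beta_linear: "Vector_Spaces.linear scale scale \<beta>"
    and alpha_beta_commute: "\<alpha> \<circ> \<beta> = \<beta> \<circ> \<alpha>"
    and alpha_prec: "\<alpha> (x \<prec> y) = \<alpha> x \<prec> \<alpha> y"
    and alpha_succ: "\<alpha> (x \<succ> y) = \<alpha> x \<succ> \<alpha> y"
    and alpha_vee: "\<alpha> (x \<squnion> y) = \<alpha> x \<squnion> \<alpha> y"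
    and beta_prec: "\<beta> (x \<prec> y) = \<beta> x \<prec> \<beta> y"
    and beta_succ: "\<beta> (x \<succ> y) = \<beta> x \<succ> \<beta> y"
    and beta_vee: "\<beta> (x \<squnion> y) = \<beta> x \<squnion> \<beta> y"
    and prec_prec: "(x \<prec> y) \<prec> \<beta> z = \<alpha> x \<prec> (y \<prec> z + y \<succ> z + y \<squnion> z)"
    and succ_prec: "(x \<succ> y) \<prec> \<beta> z = \<alpha> x \<succ> (y \<prec> z)"
    and star_succ: "(x \<prec> y + x \<succ> y + x \<squnion> y) \<succ> \<beta> z = \<alpha> x \<succ> (y \<succ> z)"
    and vee_star: "(x \<squnion> y) \<prec> \<beta> z + (x \<prec> y + x \<succ> y + x \<squnion> y) \<squnion> \<beta> z =
                   \<alpha> x \<succ> (y \<squnion> z) + \<alpha> x \<squnion> (y \<prec> z + y \<succ> z + y \<squnion> z)"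

end

theory Submission
  imports Defs
begin

text \<open>
  The Rota-Baxter identity says that \<open>\<pi>\<close> carries the total product \<open>*\<close> on \<open>M\<close> to the product of
  \<open>A\<close>. Hence \<open>\<pi>\<close> turns the first three NS-axioms into the three bimodule associativity laws, and the
  fourth into the cocycle identity.
\<close>

text \<open>Each of the three operations on M is a structure map with \<open>\<pi>\<close> or the
  identity inserted in its slots, so this one fact gives bilinearity for all of them.\<close>

lemma bilinear_map_compose:
  assumes f: "bilinear_map s1 s2 s3 f"
    and p: "Vector_Spaces.linear t1 s1 p" and q: "Vector_Spaces.linear t2 s2 q"
  shows "bilinear_map t1 t2 s3 (\<lambda>u v. f (p u) (q v))"
  unfolding bilinear_map_def
proof (intro conjI allI)
  fix u
  have "Vector_Spaces.linear s2 s3 (f (p u))"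
    using f by (simp add: bilinear_map_def)
  from Vector_Spaces.linear_compose[OF q this] show "Vector_Spaces.linear t2 s3 (\<lambda>v. f (p u) (q v))"
    by (simp add: o_def)
next
  fix v
  have "Vector_Spaces.linear s1 s3 (\<lambda>x. f x (q v))"
    using f by (simp add: bilinear_map_def)
  from Vector_Spaces.linear_compose[OF p this] show "Vector_Spaces.linear t1 s3 (\<lambda>u. f (p u) (q v))"
    by (simp add: o_def)
qed

context twisted_rota_baxter_operator
begin

lemma pi_alphaM: "\<pi> (\<alpha>M m) = \<alpha>A (\<pi> m)"
  using pi_alpha by (rule comp_eq_dest)

lemma pi_betaM: "\<pi> (\<beta>M m) = \<beta>A (\<pi> m)"
  using pi_beta by (rule comp_eq_dest)

text \<open>The Rota-Baxter identity, with summands reordered as in the NS-axioms and oriented so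
  that \<open>\<pi>\<close> of a total product rewrites to a product in A.\<close>

lemma pi_star: "\<pi> (m \<lhd> \<pi> n + \<pi> m \<rhd> n + H (\<pi> m) (\<pi> n)) = \<pi> m \<odot> \<pi> n"
  by (simp add: pi_rota_baxter add.commute)

lemma bihom_ns_algebra:
  "bihom_ns_algebra scaleM (\<lambda>m n. m \<lhd> \<pi> n) (\<lambda>m n. \<pi> m \<rhd> n) (\<lambda>m n. H (\<pi> m) (\<pi> n)) \<alpha>M \<beta>M"
proof (rule bihom_ns_algebra.intro[OF M.vector_space_axioms],
    rule bihom_ns_algebra_axioms.intro, goal_cases)
  \<comment> \<open>The identity fills the slot that \<open>\<pi>\<close> leaves untouched.\<close>
  case 1
  show ?case
    using bilinear_map_compose[OF right_act_bilinear M.linear_ident pi_linear] .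
next
  case 2
  show ?case
    using bilinear_map_compose[OF left_act_bilinear pi_linear M.linear_ident] .
next
  case 3
  show ?case
    using bilinear_map_compose[OF H_bilinear pi_linear pi_linear] .
next
  \<comment> \<open>The axiom mixing \<open>\<squnion>\<close> and the total product: once
    \<open>pi_star\<close> removes both totals, it is the cocycle identity with its two negative
    terms moved across.\<close>
  case (16 x y z)
  show ?case
    using H_cocycle[of "\<pi> x" "\<pi> y" "\<pi> z"]
    unfolding pi_star pi_alphaM pi_betaM by (simp add: algebra_simps)
\<comment> \<open>Multiplicativity holds because \<open>\<pi>\<close> intertwines the twisting maps.
  The axioms \<open>prec_prec\<close>, \<open>succ_prec\<close> and \<open>star_succ\<close> become
  the right, mixed and left associativity laws, in that order.\<close>
qed (simp_all add: alphaM_linear betaM_linear alphaM_betaM_commute pi_alphaM pi_betaM pi_star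
       alphaM_left_act betaM_left_act alphaM_right_act betaM_right_act H_alpha H_beta
       left_act_assoc right_act_assoc left_right_act_assoc)

end

theorem proposition3p3:
  fixes scaleA :: "'k::field \<Rightarrow> 'a::ab_group_add \<Rightarrow> 'a"
    and mult :: "'a \<Rightarrow> 'a \<Rightarrow> 'a"
    and \<alpha>A \<beta>A :: "'a \<Rightarrow> 'a"
    and scaleM :: "'k \<Rightarrow> 'm::ab_group_add \<Rightarrow> 'm"
    and left_act :: "'a \<Rightarrow> 'm \<Rightarrow> 'm"
    and right_act :: "'m \<Rightarrow> 'a \<Rightarrow> 'm"
    and \<alpha>M \<beta>M :: "'m \<Rightarrow> 'm"
    and H :: "'a \<Rightarrow> 'a \<Rightarrow> 'm"
    and \<pi> :: "'m \<Rightarrow> 'a"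
  assumes "bihom_associative_algebra scaleA mult \<alpha>A \<beta>A"
    and "bihom_bimodule scaleA mult \<alpha>A \<beta>A scaleM left_act right_act \<alpha>M \<beta>M"
    and "hochschild_2_cocycle scaleA mult \<alpha>A \<beta>A scaleM left_act right_act \<alpha>M \<beta>M H"
    and "twisted_rota_baxter_operator scaleA mult \<alpha>A \<beta>A scaleM left_act right_act \<alpha>M \<beta>M H \<pi>"
  shows "bihom_ns_algebra scaleM
           (\<lambda>m n. right_act m (\<pi> n))
           (\<lambda>m n. left_act (\<pi> m) n)
           (\<lambda>m n. H (\<pi> m) (\<pi> n))
           \<alpha>M \<beta>M"
  using assms(4) by (rule twisted_rota_baxter_operator.bihom_ns_algebra)

end
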